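(* Consider the continuous-time three-pursuer one-evader game in $\mathbb{R}^2$ in which all players have unit speed, the initial evader position $E(0)$ lies strictly inside the convex hull of the initial pursuer positions $P_1(0),P_2(0),P_3(0)$, and all players have complete information about the state of the game. Let $V_1(0),V_2(0),V_3(0)$ be the vertices of the initial Voronoi cell of the evader, with $P_i$ the pursuer farthest from $V_i$. Let $$i^*=\arg\max_{i=1,2,3}\frac12\left(\|V_i(0)-P_i(0)\|+\|V_i(0)-E(0)\|\right),$$ and set $V^*(t)=V_{i^*}(t)$, $P^*(t)=P_{i^*}(t)$ for all $t$. Then, for any possible pursuers' strategy, the evader is able to survive for at least a time $\underline{B}$, where $$\begin{aligned}\underline{B}&=\frac12\left(\|V^*(0)-P^*(0)\|+\|V^*(0)-E(0)\|\right)\\&=\max_{i=1,2,3}\frac12\left(\|V_i(0)-P_i(0)\|+\|V_i(0)-E(0)\|\right)\\&=\max_{i=1,2,3}\left(\|V_i(0)-E(0)\|+\frac12\left(\|V_i(0)-P_i(0)\|-\|V_i(0)-E(0)\|\right)\right).\end{aligned}$$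
   Context: **Game.** $E(t)\in\mathbb{R}^2$ and $P_i(t)\in\mathbb{R}^2$, $i=1,2,3$, are the evader and pursuer positions, with $\dot E(t)=e(t)$, $\dot P_i(t)=w_i(t)$, $\|e(t)\|=\|w_i(t)\|=1$; players can move in any direction in the whole plane. Pursuers may choose $w_i(t)$ depending on $P_1(t),P_2(t),P_3(t),E(t)$ and $e(t)$; the evader knows the full state of the game. Capture occurs at the first time $t$ with $P_i(t)=E(t)$ for some $i$; the evader survives up to that time. **Voronoi cell.** $\mathcal{V}(t)$ is the set of points of the plane closer to $E(t)$ than to every $P_i(t)$. Under the assumptions, $\mathcal{V}(0)$ is a triangle; $V_i(t)$, $i=1,2,3$, denote the vertices of the cell. Pursuers are labelled so that $P_i$ is the pursuer farthest from $V_i$ (i.e. the edge opposite to $V_i$ lies on the perpendicular bisector of $\overline{EP_i}$). **Limit convention.** When the evader is said to move to a point on the boundary of the Voronoi cell, it is meant that it moves to an interior point of the cell at distance less than $\delta$ from it, for a small $\delta>0$; all results are understood as limits for $\delta\to0$. Accordingly, "survive for at least a time $\underline{B}$" means that, for every $\eta>0$, the evader can avoid capture up to time $\underline{B}-\eta$. *)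

theory Defs
  imports "HOL-Analysis.Analysis"
begin

type_synonym point = "real^2"

text \<open>The positions of the three pursuers at one instant.\<close>
type_synonym pursuers = "3 \<Rightarrow> point"

text \<open>The arguments are the time, the current positions of the pursuers and of the evader, and
  the current velocity of the evader. Admitting the time makes every measurable pursuer motion
  the outcome of some strategy; a state feedback simply ignores it.\<close>
type_synonym pursuit_law = "real \<Rightarrow> pursuers \<Rightarrow> point \<Rightarrow> point \<Rightarrow> 3 \<Rightarrow> point"

text \<open>Maps the motion of the pursuers to the velocity of the evader as a function of time. The
  evader's own position is determined by its initial position and its past velocities, so it need
  not be an argument.\<close>
type_synonym evasion_law = "(real \<Rightarrow> pursuers) \<Rightarrow> real \<Rightarrow> point"

definition voronoi_cell :: "pursuers \<Rightarrow> point \<Rightarrow> point set" where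
  "voronoi_cell P E = {x. \<forall>i. dist x E < dist x (P i)}"

definition voronoi_vertices :: "pursuers \<Rightarrow> point \<Rightarrow> point set" where
  "voronoi_vertices P E = {v. v extreme_point_of closure (voronoi_cell P E)}"

definition pursuit_strategy :: "pursuit_law \<Rightarrow> bool" where
  "pursuit_strategy W \<longleftrightarrow> (\<forall>t Q x u i. norm u = 1 \<longrightarrow> norm (W t Q x u i) = 1)"

text \<open>The pursuers react to the current evader velocity, so the evader has to commit first: at
  each decision time \<open>\<tau> k\<close> it fixes its velocity until the next decision time on the basis of what
  it has observed up to \<open>\<tau> k\<close>. The evader's velocity is thus well defined against any
  behaviour of the pursuers, and the evader cannot win by preventing a play from existing.\<close>
definition evader_strategy :: "evasion_law \<Rightarrow> bool" where
  "evader_strategy \<sigma> \<longleftrightarrow>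
     (\<forall>P. \<forall>t\<ge>0. norm (\<sigma> P t) = 1 \<and> \<sigma> P integrable_on {0..t}) \<and>
     (\<exists>\<tau>::nat \<Rightarrow> real. \<tau> 0 = 0 \<and> strict_mono \<tau> \<and> filterlim \<tau> at_top sequentially \<and>
        (\<forall>k P P'. (\<forall>s\<in>{0..\<tau> k}. P s = P' s) \<longrightarrow> (\<forall>s\<in>{0..<\<tau> (Suc k)}. \<sigma> P s = \<sigma> P' s)))"

text \<open>The equation \<open>x' = v\<close> with unit speed on \<open>{0..T}\<close>, in integral form because velocities
  may jump.\<close>
definition unit_speed_motion :: "real \<Rightarrow> (real \<Rightarrow> point) \<Rightarrow> (real \<Rightarrow> point) \<Rightarrow> bool" where
  "unit_speed_motion T v x \<longleftrightarrow>
     (\<forall>t\<in>{0..T}. norm (v t) = 1 \<and> (v has_integral (x t - x 0)) {0..t})"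

text \<open>A play is only required to exist up to the horizon \<open>T\<close>, since the game may end there.\<close>
definition play ::
  "pursuit_law \<Rightarrow> evasion_law \<Rightarrow> pursuers \<Rightarrow> point \<Rightarrow> real \<Rightarrow> (real \<Rightarrow> pursuers) \<Rightarrow> (real \<Rightarrow> point) \<Rightarrow> bool"
  where
  "play W \<sigma> P0 E0 T P E \<longleftrightarrow>
     P 0 = P0 \<and> E 0 = E0 \<and>
     unit_speed_motion T (\<sigma> P) E \<and>
     (\<forall>i. unit_speed_motion T (\<lambda>t. W t (P t) (E t) (\<sigma> P t) i) (\<lambda>t. P t i))"

text \<open>The evader's strategy may depend on the tolerance \<open>\<eta>\<close> but not on the pursuers' strategy,
  of which it only observes the effects.\<close>
definition can_survive :: "pursuers \<Rightarrow> point \<Rightarrow> real \<Rightarrow> bool" where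
  "can_survive P0 E0 B \<longleftrightarrow>
     (\<forall>\<eta>>0. \<exists>\<sigma>. evader_strategy \<sigma> \<and>
        (\<forall>W T P E. pursuit_strategy W \<longrightarrow> T \<le> B - \<eta> \<longrightarrow> play W \<sigma> P0 E0 T P E \<longrightarrow>
           (\<forall>t\<in>{0..T}. \<forall>i. P t i \<noteq> E t)))"

end

theory Submission imports Defs begin

text \<open>The evader runs straight to a point \<open>v\<close> of its Voronoi cell close to \<open>V\<^sup>*\<close>, where it arrives
  before every pursuer. There it picks a direction that has a non-positive inner product with the
  directions to the two pursuers other than \<open>P\<^sup>*\<close>; such a direction exists because there are only
  two of them. It keeps this direction forever, so these two pursuers never reach it, and \<open>P\<^sup>*\<close>
  needs at least half the distance that separates it from \<open>v\<close> at the time of the turn.\<close>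

section \<open>Motions of unit speed\<close>

text \<open>\<open>unit_speed_motion\<close> integrates from time 0 only; the piece up to
  \<open>s\<close> is subtracted.\<close>

lemma unit_speed_motion_has_integral:
  assumes "unit_speed_motion T v x" "0 \<le> s" "s \<le> t" "t \<le> T"
  shows "(v has_integral (x t - x s)) {s..t}"
proof -
  have s: "(v has_integral (x s - x 0)) {0..s}" and t: "(v has_integral (x t - x 0)) {0..t}"
    using assms by (auto simp: unit_speed_motion_def)
  have "v integrable_on {s..t}"
    by (rule integrable_on_subinterval[OF has_integral_integrable[OF t]]) (use assms in simp)
  then obtain I where I: "(v has_integral I) {s..t}" by blast
  have "(v has_integral (x s - x 0) + I) {0..t}"
    using has_integral_combine[OF _ _ s I] assms by simp
  then have "(x s - x 0) + I = x t - x 0"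
    using t has_integral_unique by blast
  then have "I = x t - x s" by (simp add: algebra_simps)
  then show ?thesis using I by simp
qed

lemma unit_speed_motion_dist_le:
  assumes "unit_speed_motion T v x" "0 \<le> s" "s \<le> t" "t \<le> T"
  shows "dist (x s) (x t) \<le> t - s"
proof -
  have "norm (x t - x s) \<le> 1 * measure lborel (cbox s t)"
    using unit_speed_motion_has_integral[OF assms] assms
    by (intro has_integral_bound[where f = v]) (auto simp: unit_speed_motion_def)
  then show ?thesis using assms by (simp add: dist_norm norm_minus_commute)
qed

lemma unit_speed_motion_straight:
  assumes "unit_speed_motion T v x" "0 \<le> s" "s \<le> t" "t \<le> T"
    and const: "\<And>r. s \<le> r \<Longrightarrow> r < t \<Longrightarrow> v r = c"
  shows "x t = x s + (t - s) *\<^sub>R c"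
proof -
  have "((\<lambda>_. c) has_integral (x t - x s)) {s..t}"
    \<comment> \<open>The velocity may already have switched at \<open>t\<close> itself; a single
      point does not affect the integral.\<close>
    by (rule has_integral_spike_finite[of "{t}", OF _ _ unit_speed_motion_has_integral[OF assms(1-4)]])
      (use const in auto)
  moreover have "((\<lambda>_. c) has_integral (t - s) *\<^sub>R c) {s..t}"
    using has_integral_const_real[of c s t] assms by simp
  ultimately have "x t - x s = (t - s) *\<^sub>R c" by (rule has_integral_unique)
  then show ?thesis by (simp add: algebra_simps)
qed

section \<open>Escape directions\<close>

lemma exists_unit_inner_le_0:
  fixes a b :: point
  shows "\<exists>u. norm u = 1 \<and> a \<bullet> u \<le> 0 \<and> b \<bullet> u \<le> 0"
proof -
  \<comment> \<open>Orthogonality to \<open>a\<close> survives a change of sign, so the sign is free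
    to settle the inequality for \<open>b\<close>.\<close>
  obtain w where w: "w \<noteq> 0" "a \<bullet> w = 0"
    by (rule orthogonal_to_vector_exists[of a]) (auto simp: orthogonal_def)
  define u where "u = (if b \<bullet> w \<le> 0 then 1 else - 1) *\<^sub>R sgn w"
  have "norm u = 1" using w by (simp add: u_def norm_sgn)
  moreover have "a \<bullet> u = 0" using w by (simp add: u_def sgn_div_norm)
  moreover have "b \<bullet> u \<le> 0"
    by (auto simp: u_def sgn_div_norm divide_inverse_commute[symmetric] divide_nonpos_nonneg)
  ultimately show ?thesis by (metis order_refl)
qed

lemma exists_escape_direction:
  fixes Q :: pursuers and v :: point
  shows "\<exists>u. norm u = 1 \<and> (\<forall>j. j \<noteq> i \<longrightarrow> (Q j - v) \<bullet> u \<le> 0)"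
proof -
  have "card (UNIV - {i}) = 2" by (simp add: card_Diff_singleton)
  then obtain j k where jk: "UNIV - {i} = {j, k}" unfolding card_2_iff by blast
  then have others: "l = j \<or> l = k" if "l \<noteq> i" for l
    using that by (auto simp: set_eq_iff)
  obtain u where "norm u = 1" "(Q j - v) \<bullet> u \<le> 0" "(Q k - v) \<bullet> u \<le> 0"
    using exists_unit_inner_le_0 by blast
  then show ?thesis using others by metis
qed

text \<open>In the expanded square of the distance, the mixed term only adds to the square of
  \<open>s\<close>, and the square of \<open>norm (y - v)\<close> is positive. So a unit-speed
  pursuer that starts at \<open>y\<close> cannot catch within time \<open>s\<close> an evader
  leaving \<open>v\<close> along \<open>u\<close>.\<close>

lemma dist_straight_gt:
  fixes v u y :: "'a::real_inner"
  assumes "norm u = 1" "(y - v) \<bullet> u \<le> 0" "y \<noteq> v" "0 \<le> s"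
  shows "s < dist y (v + s *\<^sub>R u)"
proof -
  have "(dist y (v + s *\<^sub>R u))\<^sup>2 = (norm (y - v))\<^sup>2 - 2 * s * ((y - v) \<bullet> u) + s\<^sup>2"
  proof -
    have "u \<bullet> u = 1" using assms(1) by (simp add: norm_eq_1)
    moreover have "y - (v + s *\<^sub>R u) = (y - v) - s *\<^sub>R u" by simp
    ultimately show ?thesis
      unfolding dist_norm power2_norm_eq_inner
      by (simp only:) (simp add: inner_diff_left[of "y - v"] inner_diff_right[of _ "y - v"]
          inner_commute[of u "y - v"] power2_eq_square right_diff_distrib)
  qed
  moreover have "s * ((y - v) \<bullet> u) \<le> 0" using assms by (simp add: mult_nonneg_nonpos)
  moreover have "0 < (norm (y - v))\<^sup>2" using assms by simp
  ultimately have "s\<^sup>2 < (dist y (v + s *\<^sub>R u))\<^sup>2" by linarith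
  then show ?thesis by (rule power2_less_imp_less) simp
qed

section \<open>The evader's strategy\<close>

text \<open>The choice is a function of the observed positions \<open>Q\<close>, so equal
  observations give equal velocities, as \<open>evader_strategy\<close> demands.\<close>

definition escape_direction :: "3 \<Rightarrow> point \<Rightarrow> pursuers \<Rightarrow> point" where
  "escape_direction i v Q = (SOME u. norm u = 1 \<and> (\<forall>j. j \<noteq> i \<longrightarrow> (Q j - v) \<bullet> u \<le> 0))"

lemma escape_direction:
  shows norm_escape_direction: "norm (escape_direction i v Q) = 1"
    and inner_escape_direction: "j \<noteq> i \<Longrightarrow> (Q j - v) \<bullet> escape_direction i v Q \<le> 0"
  using someI_ex[OF exists_escape_direction[of i Q v]] by (auto simp: escape_direction_def)

definition turn_law :: "3 \<Rightarrow> point \<Rightarrow> point \<Rightarrow> evasion_law" where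
  "turn_law i E0 v P t =
     (if t < dist E0 v then sgn (v - E0) else escape_direction i v (P (dist E0 v)))"

lemma evader_strategy_turn_law:
  assumes "E0 \<noteq> v"
  shows "evader_strategy (turn_law i E0 v)"
proof -
  define r where "r = dist E0 v"
  have r: "r > 0" using assms by (simp add: r_def)
  have norm1: "norm (turn_law i E0 v P t) = 1" for P t
    using assms by (simp add: turn_law_def norm_sgn norm_escape_direction)
  have integrable: "turn_law i E0 v P integrable_on {0..t}" if "t \<ge> 0" for P t
  proof -
    have left: "turn_law i E0 v P integrable_on {0..r}"
      by (rule integrable_spike_finite[of "{r}" _ _ "\<lambda>_. sgn (v - E0)"])
        (auto simp: turn_law_def r_def)
    \<comment> \<open>Ending at \<open>r + t\<close> places the turn inside the combined interval
      for every \<open>t\<close>, which avoids a case split.\<close>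
    have right: "turn_law i E0 v P integrable_on {r..r + t}"
      by (rule integrable_spike_finite[of "{}" _ _ "\<lambda>_. escape_direction i v (P r)"])
        (auto simp: turn_law_def r_def)
    have "turn_law i E0 v P integrable_on {0..r + t}"
      using Henstock_Kurzweil_Integration.integrable_combine[OF _ _ left right] r that by simp
    then show ?thesis
      by (rule integrable_on_subinterval) (use r in auto)
  qed
  have "\<exists>\<tau>::nat \<Rightarrow> real. \<tau> 0 = 0 \<and> strict_mono \<tau> \<and> filterlim \<tau> at_top sequentially \<and>
    (\<forall>k P P'. (\<forall>s\<in>{0..\<tau> k}. P s = P' s) \<longrightarrow>
      (\<forall>s\<in>{0..<\<tau> (Suc k)}. turn_law i E0 v P s = turn_law i E0 v P' s))"
  \<comment> \<open>The turn is the decision time with \<open>k = 1\<close>. Before it the law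
    ignores \<open>P\<close>; for \<open>k\<close> at least 1 the observed period contains
    \<open>r\<close>. The further multiples make the sequence unbounded.\<close>
  proof (intro exI[of _ "\<lambda>k. real k * r"] conjI allI impI ballI)
    show "strict_mono (\<lambda>k. real k * r)" using r by (simp add: strict_mono_def)
    show "filterlim (\<lambda>k. real k * r) at_top sequentially"
      using r by (intro filterlim_at_top_mult_tendsto_pos[OF tendsto_const]
          filterlim_real_sequentially) auto
  next
    fix k s and P P' :: "real \<Rightarrow> pursuers"
    assume eq: "\<forall>s\<in>{0..real k * r}. P s = P' s" and s: "s \<in> {0..<real (Suc k) * r}"
    show "turn_law i E0 v P s = turn_law i E0 v P' s"
    proof (cases k)
      case 0
      then show ?thesis using s by (simp add: turn_law_def r_def)
    next
      case (Suc l)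
      then have "P r = P' r" using eq r by simp
      then show ?thesis by (simp add: turn_law_def r_def)
    qed
  qed simp
  then show ?thesis using norm1 integrable by (simp add: evader_strategy_def)
qed

lemma turn_law_survives:
  assumes v: "v \<in> voronoi_cell P0 E0" "E0 \<noteq> v"
    and W: "play W (turn_law i E0 v) P0 E0 T P E"
    and t: "0 \<le> t" "t \<le> T" "t < 1/2 * (dist v (P0 i) + dist v E0)"
  shows "P t j \<noteq> E t"
proof -
  define r where "r = dist E0 v"
  define u where "u = escape_direction i v (P r)"
  have r: "r > 0" using v by (simp add: r_def)
  have init: "P 0 = P0" "E 0 = E0"
    and E: "unit_speed_motion T (turn_law i E0 v P) E"
    and Pm: "unit_speed_motion T (\<lambda>t. W t (P t) (E t) (turn_law i E0 v P t) j) (\<lambda>t. P t j)" for j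
    using W by (auto simp: play_def)
  have P_dist: "dist (P s j) (P t j) \<le> t - s" if "0 \<le> s" "s \<le> t" "t \<le> T" for s t j
    using unit_speed_motion_dist_le[OF Pm] that by blast
  have approach: "E s = E0 + s *\<^sub>R sgn (v - E0)" if "0 \<le> s" "s \<le> r" "s \<le> T" for s
    using unit_speed_motion_straight[OF E, of 0 s "sgn (v - E0)"] that
    by (simp add: turn_law_def r_def init)
  have v_eq: "v = E0 + r *\<^sub>R sgn (v - E0)"
    using v by (simp add: r_def sgn_div_norm dist_norm norm_minus_commute)
  \<comment> \<open>A pursuer that captures at time \<open>s\<close> is then only
    \<open>r - s\<close> away from \<open>v\<close>, hence it started within \<open>r\<close> of
    \<open>v\<close>, although \<open>v\<close> is closer to \<open>E0\<close> than to any
    pursuer.\<close>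
  have free: "P s j \<noteq> E s" if s: "0 \<le> s" "s \<le> r" "s \<le> T" for s j
  proof
    assume capture: "P s j = E s"
    have "v - E s = (r - s) *\<^sub>R sgn (v - E0)"
      using approach[OF s] v_eq by (simp add: algebra_simps)
    then have "dist v (E s) = r - s"
      using v s by (simp add: dist_norm norm_sgn)
    then have "dist v (P0 j) \<le> r"
      using capture P_dist[of 0 s j] s dist_triangle[of v "P0 j" "P s j"]
      by (simp add: init dist_commute)
    then show False
      using v by (auto simp: voronoi_cell_def r_def dist_commute not_less[symmetric])
  qed
  show ?thesis
  proof (cases "t \<le> r")
    case True
    then show ?thesis using free t by simp
  next
    case False
    then have E_r: "E r = v" using approach[of r] v_eq r t by simp
    have E_t: "E t = v + (t - r) *\<^sub>R u"
      using unit_speed_motion_straight[OF E, of r t u] False r t E_r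
      by (simp add: turn_law_def u_def r_def)
    have u: "norm u = 1" by (simp add: u_def norm_escape_direction)
    show ?thesis
    proof
      assume capture: "P t j = E t"
      show False
      proof (cases "j = i")
        case True
        have "dist v (E t) = t - r" using E_t u False by (simp add: dist_norm)
        \<comment> \<open>Triangle inequality through the capture point: the evader has run
          \<open>t - r\<close> since leaving \<open>v\<close>, the pursuer \<open>t\<close> since
          the start. Solving for \<open>t\<close> contradicts its bound.\<close>
        then have "dist v (P0 i) \<le> (t - r) + t"
          using dist_triangle[of v "P0 i" "E t"] P_dist[of 0 t i] t capture True
          by (simp add: init dist_commute)
        then show False using t by (simp add: r_def dist_commute)
      next
        case j: False
        \<comment> \<open>No capture at the turn itself: this makes the next inequality
          strict.\<close>
        have "P r j \<noteq> v" using free[of r j] r False t E_r by simp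
        then have "t - r < dist (P r j) (E t)"
          using dist_straight_gt[OF u, of "P r j" v "t - r"] inner_escape_direction[OF j] False E_t
          by (simp add: u_def)
        then show False using P_dist[of r t j] r False t capture by simp
      qed
    qed
  qed
qed

section \<open>Voronoi vertices as targets\<close>

lemma open_voronoi_cell: "open (voronoi_cell P E)"
proof -
  have "voronoi_cell P E = (\<Inter>i. {x. dist x E < dist x (P i)})"
    by (auto simp: voronoi_cell_def)
  then show ?thesis by (auto intro!: open_Collect_less continuous_intros)
qed

text \<open>Replacing \<open>V\<close> by a point \<open>v\<close> of the cell at distance less than
  \<eta> lowers the mean of the two distances by less than \<eta>, the tolerance in
  \<open>can_survive\<close>.\<close>

lemma can_survive_voronoi_vertex:
  assumes V: "V \<in> voronoi_vertices P0 E0"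
  shows "can_survive P0 E0 (1/2 * (dist V (P0 i) + dist V E0))"
  unfolding can_survive_def
proof (intro allI impI)
  fix \<eta> :: real
  assume \<eta>: "\<eta> > 0"
  have extreme: "V extreme_point_of closure (voronoi_cell P0 E0)"
    using V by (simp add: voronoi_vertices_def)
  then have closure: "V \<in> closure (voronoi_cell P0 E0)"
    by (simp add: extreme_point_of_def)
  \<comment> \<open>A pursuer at \<open>E0\<close> would make the cell empty, but its closure
    contains \<open>V\<close>.\<close>
  then obtain x where "x \<in> voronoi_cell P0 E0"
    by (metis all_not_in_conv closure_empty)
  then have "P0 j \<noteq> E0" for j by (auto simp: voronoi_cell_def)
  then have "E0 \<in> voronoi_cell P0 E0" by (auto simp: voronoi_cell_def)
  then have "E0 \<in> interior (closure (voronoi_cell P0 E0))"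
    using interior_maximal[OF closure_subset open_voronoi_cell] by (rule rev_subsetD)
  then have "V \<noteq> E0" using extreme extreme_point_not_in_interior[of V] by auto
  \<comment> \<open>The bound \<open>dist V E0\<close> keeps \<open>v\<close> different from
    \<open>E0\<close>, so that the initial velocity \<open>sgn (v - E0)\<close> is a unit
    vector.\<close>
  then obtain v where v: "v \<in> voronoi_cell P0 E0" "dist v V < min \<eta> (dist V E0)"
    using closure \<eta> unfolding closure_approachable
    by (meson min_less_iff_conj zero_less_dist_iff)
  then have "E0 \<noteq> v" by (auto simp: dist_commute)
  show "\<exists>\<sigma>. evader_strategy \<sigma> \<and>
    (\<forall>W T P E. pursuit_strategy W \<longrightarrow> T \<le> 1/2 * (dist V (P0 i) + dist V E0) - \<eta> \<longrightarrow>
      play W \<sigma> P0 E0 T P E \<longrightarrow> (\<forall>t\<in>{0..T}. \<forall>i. P t i \<noteq> E t))"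
  proof (intro exI[of _ "turn_law i E0 v"] conjI allI impI ballI)
    show "evader_strategy (turn_law i E0 v)"
      using \<open>E0 \<noteq> v\<close> by (rule evader_strategy_turn_law)
  next
    fix W T P E t j
    assume T: "T \<le> 1/2 * (dist V (P0 i) + dist V E0) - \<eta>"
      and W: "play W (turn_law i E0 v) P0 E0 T P E" and t: "t \<in> {0..T}"
    have "dist V (P0 i) \<le> dist v V + dist v (P0 i)" "dist V E0 \<le> dist v V + dist v E0"
      by (metis dist_commute dist_triangle)+
    then have "t < 1/2 * (dist v (P0 i) + dist v E0)"
      using T t v by (simp add: field_simps)
    then show "P t j \<noteq> E t"
      using turn_law_survives[OF v(1) \<open>E0 \<noteq> v\<close> W] t by simp
  qed
qed

theorem theorem2:
  fixes P0 :: pursuers and E0 :: point and V :: "3 \<Rightarrow> point" and istar :: 3 and B :: real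
  assumes inside: "E0 \<in> interior (convex hull (range P0))"
    and vertices: "bij_betw V UNIV (voronoi_vertices P0 E0)"
    and labels: "\<And>i j. dist (V i) (P0 j) \<le> dist (V i) (P0 i)"
    and istar: "is_arg_max (\<lambda>i. 1/2 * (dist (V i) (P0 i) + dist (V i) E0)) (\<lambda>_. True) istar"
    and B: "B = 1/2 * (dist (V istar) (P0 istar) + dist (V istar) E0)"
  shows "can_survive P0 E0 B
    \<and> B = (MAX i. 1/2 * (dist (V i) (P0 i) + dist (V i) E0))
    \<and> B = (MAX i. dist (V i) E0 + 1/2 * (dist (V i) (P0 i) - dist (V i) E0))"
proof (intro conjI)
  have "V istar \<in> voronoi_vertices P0 E0"
    using vertices by (auto simp: bij_betw_def)
  then show "can_survive P0 E0 B"
    unfolding B by (rule can_survive_voronoi_vertex)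
  show max: "B = (MAX i. 1/2 * (dist (V i) (P0 i) + dist (V i) E0))"
    unfolding B using istar
    by (intro Max_eqI[symmetric]) (auto simp: is_arg_max_def not_less)
  have eq: "(\<lambda>i. dist (V i) E0 + 1/2 * (dist (V i) (P0 i) - dist (V i) E0))
      = (\<lambda>i. 1/2 * (dist (V i) (P0 i) + dist (V i) E0))"
    by (simp add: field_simps)
  show "B = (MAX i. dist (V i) E0 + 1/2 * (dist (V i) (P0 i) - dist (V i) E0))"
    unfolding eq by (rule max)
qed

end
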